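(* Let $n>4$ and $(X,T)\in\mathbb{R}^n\times\mathbb{R}$. Suppose the smooth one-parameter family of pairs $\{(A(\cdot,t),u(\cdot,t))\}_{t\in(-\infty,T)}$ on $\mathbb{R}^n$ is such that $A$ is self similar about $(X,T)$, i.e. for all $r>0$, all $i\in\{1,\dots,n\}$ and all $(x,t)\in\mathbb{R}^n\times(-\infty,T)$, $$r A_i\big(X+r(x-X),\,T+r^2(t-T)\big)=A_i(x,t),$$ and such that $D_iu\equiv0$ for all $i\in\{1,\dots,n\}$ and $W(|u|^2)\equiv0$ on $\mathbb{R}^n\times(-\infty,T)$. Then for all $t\in(-\infty,T)$ and $r>0$, $$\int_{\mathbb{R}^n}e(A,u)(x,t)\cdot\Phi_{(X,T)}(x,t)\,dx=\frac{1}{r^{n-4}}\iint_{E_r(X,T)}e(A,u)(y,s)\cdot\frac{n-4}{2(T-s)}\,dy\,ds.$$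
   Context: Setting. $G$ is a connected compact finite-dimensional semisimple Lie group with Lie algebra $(\mathfrak{g},[\cdot,\cdot])$, equipped with the $\mathrm{Ad}$-invariant inner product $\langle A,B\rangle=-\mathrm{tr}(\mathrm{ad}_A\circ\mathrm{ad}_B)$ (negative Killing form). $\rho:G\to \mathrm{GL}(V)$ is a smooth representation on a finite-dimensional real inner product space $(V,\langle\cdot,\cdot\rangle)$ whose inner product is $\rho$-invariant; $Z\cdot v$ (for $Z\in\mathfrak{g}$, $v\in V$) is the action of $\mathfrak{g}$ on $V$ obtained by differentiating $\rho$ at the identity. $W\in C^1(\mathbb{R},\mathbb{R}^+)$ is a given potential, where $\mathbb{R}^+=[0,\infty)$. All norms $|\cdot|$ on $\mathfrak{g}$ and $V$ are those of the inner products. Pairs. A pair $(A,u)$ consists of a gauge field $A=\sum_i A_i\otimes dx^i$ with $A_i:\mathbb{R}^n\to\mathfrak{g}$ smooth, and a scalar field $u:\mathbb{R}^n\to V$, smooth. The curvature is $F_{ij}=\partial_iA_j-\partial_jA_i+[A_i,A_j]$ and the covariant derivative of $V$-valued functions is $D_i v=\partial_i v+A_i\cdot v$. The energy density is $$e(A,u)=\frac12\Big(\sum_{i<j}|F_{ij}|^2+\sum_i|D_iu|^2\Big)+W(|u|^2).$$ Heat balls. For $(x,t)\in\mathbb{R}^n\times(-\infty,T)$, $$\Phi_{(X,T)}(x,t)=\frac{1}{(4\pi(T-t))^{\frac{n-4}{2}}}\exp\left(\frac{|x-X|^2}{4(t-T)}\right),$$ and for $r>0$, $E_r(X,T)=\{(x,t)\in\mathbb{R}^n\times(-\infty,T):\Phi_{(X,T)}(x,t)>r^{-(n-4)}\}$.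 Integrals of nonnegative functions are understood with values in $[0,\infty]$. *)

theory Defs
  imports "HOL-Analysis.Analysis" "HOL-Algebra.Group"
begin

section \<open>Smooth maps between finite-dimensional spaces\<close>

definition finite_dim :: "'a::real_vector itself \<Rightarrow> bool" where
  "finite_dim _ \<longleftrightarrow> (\<exists>B::'a set. finite B \<and> span B = UNIV)"

(* On an open set S of a finite-dimensional space: f is k times continuously differentiable. *)
primrec Ck_on :: "nat \<Rightarrow> 'a::real_normed_vector set \<Rightarrow> ('a \<Rightarrow> 'b::real_normed_vector) \<Rightarrow> bool" where
  "Ck_on 0 S f \<longleftrightarrow> continuous_on S f"
| "Ck_on (Suc k) S f \<longleftrightarrow>
     (\<forall>x\<in>S. f differentiable (at x)) \<and> (\<forall>v. Ck_on k S (\<lambda>x. frechet_derivative f (at x) v))"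

definition smooth_on :: "'a::real_normed_vector set \<Rightarrow> ('a \<Rightarrow> 'b::real_normed_vector) \<Rightarrow> bool" where
  "smooth_on S f \<longleftrightarrow> (\<forall>k. Ck_on k S f)"


section \<open>Smooth manifolds\<close>

(* A chart is a pair (U, \<phi>) of an open domain and a coordinate map; the values of \<phi> outside U
   are irrelevant. *)
type_synonym ('a, 'g) chart = "'a set \<times> ('a \<Rightarrow> 'g)"

definition is_chart :: "'a topology \<Rightarrow> ('a, 'g::real_normed_vector) chart \<Rightarrow> bool" where
  "is_chart X c \<longleftrightarrow> (case c of (U, \<phi>) \<Rightarrow>
     openin X U \<and> open (\<phi> ` U) \<and>
     homeomorphic_map (subtopology X U) (top_of_set (\<phi> ` U)) \<phi>)"

definition smooth_atlas :: "'a topology \<Rightarrow> ('a, 'g::real_normed_vector) chart set \<Rightarrow> bool" where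
  "smooth_atlas X \<A> \<longleftrightarrow>
     (\<forall>c\<in>\<A>. is_chart X c) \<and> (\<Union>(U, \<phi>)\<in>\<A>. U) = topspace X \<and>
     (\<forall>(U, \<phi>)\<in>\<A>. \<forall>(V, \<psi>)\<in>\<A>. smooth_on (\<phi> ` (U \<inter> V)) (\<psi> \<circ> inv_into U \<phi>))"

definition prod_atlas ::
  "('a, 'g) chart set \<Rightarrow> ('b, 'h) chart set \<Rightarrow> ('a \<times> 'b, 'g \<times> 'h) chart set" where
  "prod_atlas \<A> \<B> = {(U \<times> V, map_prod \<phi> \<psi>) | U \<phi> V \<psi>. (U, \<phi>) \<in> \<A> \<and> (V, \<psi>) \<in> \<B>}"

definition standard_atlas :: "('v, 'v) chart set" where
  "standard_atlas = {(UNIV, id)}"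

definition smooth_map ::
  "'a topology \<Rightarrow> ('a, 'g::real_normed_vector) chart set \<Rightarrow>
   'b topology \<Rightarrow> ('b, 'h::real_normed_vector) chart set \<Rightarrow> ('a \<Rightarrow> 'b) \<Rightarrow> bool" where
  "smooth_map X \<A> Y \<B> f \<longleftrightarrow>
     continuous_map X Y f \<and>
     (\<forall>(U, \<phi>)\<in>\<A>. \<forall>(V, \<psi>)\<in>\<B>. smooth_on (\<phi> ` (U \<inter> f -` V)) (\<psi> \<circ> f \<circ> inv_into U \<phi>))"


section \<open>Lie groups and their Lie algebras\<close>

(* The model space 'g is only required to be finite-dimensional, so that dimension 0 is allowed.
   Its own inner product plays no geometric role. *)
locale lie_group = group G
  for G :: "('a, 'm) monoid_scheme" (structure)
    and X :: "'a topology"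
    and \<A> :: "('a, 'g::real_inner) chart set" +
  assumes topspace: "topspace X = carrier G"
    and Hausdorff: "Hausdorff_space X"
    and second_countable: "second_countable X"
    and model_finite_dim: "finite_dim TYPE('g)"
    and atlas: "smooth_atlas X \<A>"
    and smooth_mult: "smooth_map (prod_topology X X) (prod_atlas \<A> \<A>) X \<A> (\<lambda>(g, h). g \<otimes> h)"
    and smooth_inv: "smooth_map X \<A> X \<A> (\<lambda>g. inv g)"

(* A chart (U, \<phi>) with \<one> \<in> U identifies the Lie algebra, i.e. the tangent space at \<one>, with the
   model space 'g via the differential of \<phi> at \<one>. In this chart, the left-invariant vector field
   generated by Z is x \<mapsto> d(L_g)_\<one> Z, where g is the point with coordinates x. *)
definition left_invariant_field ::
  "('a, 'm) monoid_scheme \<Rightarrow> ('a, 'g::real_normed_vector) chart \<Rightarrow> 'g \<Rightarrow> 'g \<Rightarrow> 'g" where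
  "left_invariant_field G c Z x = (case c of (U, \<phi>) \<Rightarrow>
     frechet_derivative (\<lambda>y. \<phi> (inv_into U \<phi> x \<otimes>\<^bsub>G\<^esub> inv_into U \<phi> y)) (at (\<phi> \<one>\<^bsub>G\<^esub>)) Z)"

definition vector_field_bracket ::
  "('g::real_normed_vector \<Rightarrow> 'g) \<Rightarrow> ('g \<Rightarrow> 'g) \<Rightarrow> 'g \<Rightarrow> 'g" where
  "vector_field_bracket \<xi> \<eta> p =
     frechet_derivative \<eta> (at p) (\<xi> p) - frechet_derivative \<xi> (at p) (\<eta> p)"

definition lie_bracket ::
  "('a, 'm) monoid_scheme \<Rightarrow> ('a, 'g::real_normed_vector) chart \<Rightarrow> 'g \<Rightarrow> 'g \<Rightarrow> 'g" where
  "lie_bracket G c Y Z =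
     vector_field_bracket (left_invariant_field G c Y) (left_invariant_field G c Z)
       (snd c \<one>\<^bsub>G\<^esub>)"

definition lie_ideal :: "('g::real_vector \<Rightarrow> 'g \<Rightarrow> 'g) \<Rightarrow> 'g set \<Rightarrow> bool" where
  "lie_ideal br I \<longleftrightarrow> subspace I \<and> (\<forall>x. \<forall>y\<in>I. br x y \<in> I)"

definition derived_algebra :: "('g::real_vector \<Rightarrow> 'g \<Rightarrow> 'g) \<Rightarrow> 'g set \<Rightarrow> 'g set" where
  "derived_algebra br S = span {br x y | x y. x \<in> S \<and> y \<in> S}"

definition lie_solvable :: "('g::real_vector \<Rightarrow> 'g \<Rightarrow> 'g) \<Rightarrow> 'g set \<Rightarrow> bool" where
  "lie_solvable br S \<longleftrightarrow> (\<exists>k. (derived_algebra br ^^ k) S = {0})"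

definition semisimple_lie_algebra :: "('g::real_vector \<Rightarrow> 'g \<Rightarrow> 'g) \<Rightarrow> bool" where
  "semisimple_lie_algebra br \<longleftrightarrow> (\<forall>I. lie_ideal br I \<and> lie_solvable br I \<longrightarrow> I = {0})"

(* The trace of an endomorphism of a finite-dimensional space, computed in some basis. *)
definition lin_trace :: "('g::real_vector \<Rightarrow> 'g) \<Rightarrow> real" where
  "lin_trace f =
     (let B = (SOME B. independent B \<and> span B = UNIV) in \<Sum>b\<in>B. representation B (f b) b)"

(* The negative Killing form, ad_Y being the partial application br Y. It is positive definite, so
   that ad_norm is a norm, when the group is compact and semisimple. *)
definition ad_inner :: "('g::real_vector \<Rightarrow> 'g \<Rightarrow> 'g) \<Rightarrow> 'g \<Rightarrow> 'g \<Rightarrow> real" where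
  "ad_inner br Y Z = - lin_trace (br Y \<circ> br Z)"

definition ad_norm :: "('g::real_vector \<Rightarrow> 'g \<Rightarrow> 'g) \<Rightarrow> 'g \<Rightarrow> real" where
  "ad_norm br Z = sqrt (ad_inner br Z Z)"


section \<open>Orthogonal representations\<close>

(* \<rho> takes values in the bounded linear endomorphisms, which on a finite-dimensional space are all
   endomorphisms; the homomorphism laws force the values on carrier G to be invertible, and
   smoothness into GL(V) is smoothness into the space of endomorphisms, of which GL(V) is an
   open subset. *)
definition orthogonal_representation ::
  "('a, 'm) monoid_scheme \<Rightarrow> 'a topology \<Rightarrow> ('a, 'g::real_normed_vector) chart set \<Rightarrow>
   ('a \<Rightarrow> 'v::real_inner \<Rightarrow>\<^sub>L 'v) \<Rightarrow> bool" where
  "orthogonal_representation G X \<A> \<rho> \<longleftrightarrow>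
     finite_dim TYPE('v) \<and>
     \<rho> \<one>\<^bsub>G\<^esub> = id_blinfun \<and>
     (\<forall>g\<in>carrier G. \<forall>h\<in>carrier G. \<rho> (g \<otimes>\<^bsub>G\<^esub> h) = \<rho> g o\<^sub>L \<rho> h) \<and>
     smooth_map X \<A> euclidean standard_atlas \<rho> \<and>
     (\<forall>g\<in>carrier G. \<forall>v w. \<rho> g v \<bullet> \<rho> g w = v \<bullet> w)"

definition lie_action ::
  "('a, 'm) monoid_scheme \<Rightarrow> ('a, 'g::real_normed_vector) chart \<Rightarrow>
   ('a \<Rightarrow> 'v::real_normed_vector \<Rightarrow>\<^sub>L 'v) \<Rightarrow> 'g \<Rightarrow> 'v \<Rightarrow> 'v" where
  "lie_action G c \<rho> Z v = (case c of (U, \<phi>) \<Rightarrow>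
     blinfun_apply (frechet_derivative (\<rho> \<circ> inv_into U \<phi>) (at (\<phi> \<one>\<^bsub>G\<^esub>)) Z) v)"


section \<open>Pairs and their energy density\<close>

definition partial :: "'n::finite \<Rightarrow> (real^'n \<Rightarrow> 'b::real_normed_vector) \<Rightarrow> real^'n \<Rightarrow> 'b" where
  "partial i f x = frechet_derivative f (at x) (axis i 1)"

definition curvature ::
  "('g::real_normed_vector \<Rightarrow> 'g \<Rightarrow> 'g) \<Rightarrow> ('n::finite \<Rightarrow> real^'n \<Rightarrow> 'g) \<Rightarrow>
   'n \<Rightarrow> 'n \<Rightarrow> real^'n \<Rightarrow> 'g" where
  "curvature br A i j x = partial i (A j) x - partial j (A i) x + br (A i x) (A j x)"

definition covariant_derivative ::
  "('g \<Rightarrow> 'v::real_normed_vector \<Rightarrow> 'v) \<Rightarrow> ('n::finite \<Rightarrow> real^'n \<Rightarrow> 'g) \<Rightarrow>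
   'n \<Rightarrow> (real^'n \<Rightarrow> 'v) \<Rightarrow> real^'n \<Rightarrow> 'v" where
  "covariant_derivative act A i v x = partial i v x + act (A i x) (v x)"

(* The linear order on the index type 'n only serves to count each pair {i, j} once. *)
definition energy_density ::
  "('g::real_normed_vector \<Rightarrow> 'g \<Rightarrow> 'g) \<Rightarrow> ('g \<Rightarrow> 'v::real_normed_vector \<Rightarrow> 'v) \<Rightarrow> (real \<Rightarrow> real) \<Rightarrow>
   ('n::{finite, linorder} \<Rightarrow> (real, 'n) vec \<Rightarrow> 'g) \<Rightarrow> ((real, 'n) vec \<Rightarrow> 'v) \<Rightarrow> (real, 'n) vec \<Rightarrow> real" where
  "energy_density br act W A u x =
     1/2 * ((\<Sum>(i, j)\<in>{(i, j). i < j}. (ad_norm br (curvature br A i j x))\<^sup>2)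
            + (\<Sum>i\<in>UNIV. (norm (covariant_derivative act A i u x))\<^sup>2))
     + W ((norm (u x))\<^sup>2)"


section \<open>Heat balls\<close>

definition heat_kernel :: "real^'n \<Rightarrow> real \<Rightarrow> real^'n \<Rightarrow> real \<Rightarrow> real" where
  "heat_kernel X T x t =
     1 / (4 * pi * (T - t)) powr ((real CARD('n) - 4) / 2) * exp ((norm (x - X))\<^sup>2 / (4 * (t - T)))"

definition heat_ball :: "real \<Rightarrow> real^'n \<Rightarrow> real \<Rightarrow> ((real^'n) \<times> real) set" where
  "heat_ball r X T =
     {(x, t). t < T \<and> heat_kernel X T x t > r powr (- (real CARD('n) - 4))}"

end

theory Submission
  imports Defs
begin

text \<open>
  Where $D_i u = 0$ and $W(|u|^2) = 0$, the energy density is that of the curvature, and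
  self-similarity makes it $\tau^{-2} g((x - X)/\sqrt{\tau})$ with $\tau = T - t$ and a fixed
  continuous $g$. Substituting $x = X + \sqrt{\tau}\, z$ turns the left-hand side into
  $\int g(z) (4\pi)^{-a} e^{-|z|^2/4}\, dz$ with $a = (n-4)/2$. The same substitution in the heat
  ball, followed by Tonelli, leaves for each $z$ the integral of $a \tau^{a-1}$ over
  $0 < \tau^a < r^{2a} (4\pi)^{-a} e^{-|z|^2/4}$, which equals that upper bound.
  The scaling and the continuity of the curvature norm only need that the Lie bracket is bilinear,
  which follows from the smoothness of the group multiplication.
\<close>

section \<open>The mean value formula for parabolically homogeneous functions\<close>

text \<open>The power of \<open>\<bar>c\<bar>\<close> is the Jacobian of the dilation.\<close>

lemma nn_integral_scaleR_affine:
  fixes f :: "'a::euclidean_space \<Rightarrow> ennreal"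
  assumes [measurable]: "f \<in> borel_measurable borel" and c: "c \<noteq> 0"
  shows "(\<integral>\<^sup>+x. f x \<partial>lborel) = ennreal (\<bar>c\<bar> ^ DIM('a)) * (\<integral>\<^sup>+x. f (t + c *\<^sub>R x) \<partial>lborel)"
  by (subst lborel_affine[OF c, of t])
     (simp add: nn_integral_density nn_integral_distr nn_integral_cmult ennreal_power)

text \<open>With \<open>x = T - s\<close> the integrand is the derivative of
  \<open>x powr a\<close>, which vanishes at 0, so the integral is the value of
  \<open>x powr a\<close> at the cutoff \<open>c = K powr (1 / a)\<close>. For \<open>a < 1\<close>
  the integrand is unbounded near 0 but still integrable.\<close>

lemma nn_integral_powr_layer:
  fixes a K T :: real
  assumes a: "a > 0" and K: "K > 0"
  shows "(\<integral>\<^sup>+s. ennreal (if s < T \<and> (T - s) powr a < K then a * (T - s) powr (a - 1) else 0) \<partial>lborel)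
    = ennreal K"
proof -
  define c where "c = K powr (1 / a)"
  have c: "c > 0" using K by (simp add: c_def)
  have ca: "c powr a = K" using a K by (simp add: c_def powr_powr)
  have less_iff: "x powr a < K \<longleftrightarrow> x < c" if "x > 0" for x
  proof
    show "x powr a < K \<Longrightarrow> x < c"
      using powr_mono2[of a c x] a c ca by (smt (verit))
    show "x < c \<Longrightarrow> x powr a < K"
      using powr_less_mono2[of a x c] a that ca by simp
  qed
  have "((\<lambda>x. a * x powr (a - 1)) has_integral a * (c powr (a - 1 + 1) / (a - 1 + 1))) {0..c}"
    using a c by (intro has_integral_mult_right has_integral_powr_from_0) auto
  then have "((\<lambda>x. a * x powr (a - 1)) has_integral K) {0<..<c}"
    using a ca by (simp add: has_integral_Icc_iff_Ioo)
  then have I: "((\<lambda>x. if x \<in> {0<..<c} then a * x powr (a - 1) else 0) has_integral K) UNIV"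
    by (simp only: has_integral_restrict_UNIV)
  have "(\<integral>\<^sup>+s. ennreal (if s < T \<and> (T - s) powr a < K then a * (T - s) powr (a - 1) else 0) \<partial>lborel)
      = (\<integral>\<^sup>+x. ennreal (if x \<in> {0<..<c} then a * x powr (a - 1) else 0) \<partial>lborel)"
    by (subst nn_integral_real_affine[where c = "-1" and t = T])
       (auto intro!: nn_integral_cong simp: less_iff)
  also have "\<dots> = ennreal K"
    using a by (intro nn_integral_has_integral_lborel[OF _ _ I]) auto
  finally show ?thesis .
qed

text \<open>In the variable \<open>z\<close> the Gaussian is free of time, which survives only in
  the power prefactor.\<close>

lemma heat_kernel_parabolic:
  fixes X z :: "real^'n"
  assumes "\<tau> > 0"
  shows "heat_kernel X T (X + sqrt \<tau> *\<^sub>R z) (T - \<tau>)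
    = (4 * pi * \<tau>) powr (- ((real CARD('n) - 4) / 2)) * exp (- ((norm z)\<^sup>2 / 4))"
  using assms
  by (simp add: heat_kernel_def powr_minus divide_simps power_mult_distrib)

text \<open>Scaling by \<open>sqrt (T - s)\<close> carries the slice of \<open>f\<close> at time
  \<open>T - 1\<close> to the slice at \<open>s\<close>, so measurability and nonnegativity of that
  single slice control \<open>f\<close> at all times before \<open>T\<close>.\<close>

lemma heat_ball_mean_value:
  fixes f :: "real \<Rightarrow> real^'n \<Rightarrow> real" and X :: "real^'n"
  assumes dim: "CARD('n) > 4"
    and meas: "f (T - 1) \<in> borel_measurable borel"
    and nonneg: "\<And>x. f (T - 1) x \<ge> 0"
    and scaling: "\<And>r x t. r > 0 \<Longrightarrow> t < T \<Longrightarrow>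
      r ^ 4 * f (T + r\<^sup>2 * (t - T)) (X + r *\<^sub>R (x - X)) = f t x"
    and t: "t < T" and r: "r > 0"
  shows "(\<integral>\<^sup>+x. ennreal (f t x * heat_kernel X T x t) \<partial>lborel) =
    ennreal (1 / r ^ (CARD('n) - 4)) *
    (\<integral>\<^sup>+(y, s)\<in>heat_ball r X T. ennreal (f s y * ((real CARD('n) - 4) / (2 * (T - s)))) \<partial>lborel)"
proof -
  define a where "a = (real CARD('n) - 4) / 2"
  have a: "a > 0" and a2: "real CARD('n) - 4 = 2 * a" using dim by (auto simp: a_def)
  have half: "(real CARD('n) - 4) / (2 * (T - s)) = a / (T - s)" for s
    unfolding a2 by (rule mult_divide_mult_cancel_left) simp
  have card: "real CARD('n) = 2 * a + 4" using a2 by simp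
  define g where "g z = f (T - 1) (X + z)" for z
  have g[measurable]: "g \<in> borel_measurable borel"
    unfolding g_def using meas by measurable
  have g0: "g z \<ge> 0" for z by (simp add: g_def nonneg)
  have f_g: "f (T - \<tau>) (X + sqrt \<tau> *\<^sub>R z) = g z / \<tau>\<^sup>2" if "\<tau> > 0" for \<tau> z
  proof -
    have "sqrt \<tau> ^ 4 = \<tau>\<^sup>2"
      using that by (metis less_imp_le mult_2 numeral_Bit0 power_add power2_eq_square real_sqrt_pow2)
    then show ?thesis
      using scaling[of "sqrt \<tau>" "T - 1" "X + z"] that by (simp add: g_def field_simps)
  qed
  have f_g': "f s y = g ((1 / sqrt (T - s)) *\<^sub>R (y - X)) / (T - s)\<^sup>2" if "s < T" for s y
    using f_g[of "T - s" "(1 / sqrt (T - s)) *\<^sub>R (y - X)"] that by simp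
  \<comment> \<open>Jacobian of \<open>z \<mapsto> X + sqrt \<tau> *\<^sub>R z\<close>. Its exponent
    \<open>a + 2\<close> exactly offsets the factor \<open>1 / \<tau>\<^sup>2\<close> of
    \<open>f_g\<close> and the factor \<open>\<tau> powr (-a)\<close> of the heat kernel.\<close>
  have volume: "sqrt \<tau> ^ CARD('n) = \<tau> powr (a + 2)" if "\<tau> > 0" for \<tau>
    using that by (simp add: powr_realpow[symmetric] card powr_half_sqrt[symmetric] powr_powr add_divide_distrib)
  define E where "E z = exp (- ((norm z)\<^sup>2 / 4))" for z :: "real^'n"
  have E[measurable]: "E \<in> borel_measurable borel" unfolding E_def by measurable
  have E0: "E z > 0" for z by (simp add: E_def)
  \<comment> \<open>The value of the left-hand side for every \<open>t < T\<close>.\<close>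
  define I where "I = (\<integral>\<^sup>+z. ennreal (g z * ((4 * pi) powr (-a) * E z)) \<partial>lborel)"

  have left: "(\<integral>\<^sup>+x. ennreal (f t x * heat_kernel X T x t) \<partial>lborel) = I"
  proof -
    define \<tau> where "\<tau> = T - t"
    have \<tau>: "\<tau> > 0" "T - \<tau> = t" using t by (auto simp: \<tau>_def)
    \<comment> \<open>Measurability of the slice at \<open>t\<close> is inherited from
      \<open>g\<close> through the scaling law.\<close>
    have "(\<lambda>x. ennreal (f t x * heat_kernel X T x t)) \<in> borel_measurable borel"
      unfolding f_g'[OF t] heat_kernel_def by measurable
    then have "(\<integral>\<^sup>+x. ennreal (f t x * heat_kernel X T x t) \<partial>lborel)
      = ennreal (\<tau> powr (a + 2)) *
        (\<integral>\<^sup>+z. ennreal (f t (X + sqrt \<tau> *\<^sub>R z) * heat_kernel X T (X + sqrt \<tau> *\<^sub>R z) t) \<partial>lborel)"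
      using \<tau>(1) by (subst nn_integral_scaleR_affine[where c = "sqrt \<tau>" and t = X])
        (auto simp: volume[symmetric])
    also have "\<dots> = ennreal (\<tau> powr (a + 2)) *
        (\<integral>\<^sup>+z. ennreal (g z / \<tau>\<^sup>2 * ((4 * pi * \<tau>) powr (-a) * E z)) \<partial>lborel)"
      using heat_kernel_parabolic[OF \<tau>(1), of X T] f_g[OF \<tau>(1)] by (simp add: \<tau>(2) a_def E_def)
    also have "\<dots> = (\<integral>\<^sup>+z. ennreal (\<tau> powr (a + 2)) *
        ennreal (g z / \<tau>\<^sup>2 * ((4 * pi * \<tau>) powr (-a) * E z)) \<partial>lborel)"
      by (rule nn_integral_cmult[symmetric]) measurable
    also have "\<dots> = I"
      unfolding I_def
    proof (intro nn_integral_cong)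
      fix z
      have "\<tau> powr (a + 2) * (g z / \<tau>\<^sup>2 * ((4 * pi * \<tau>) powr (-a) * E z)) = g z * ((4 * pi) powr (-a) * E z)"
        using \<tau>(1) by (simp add: powr_mult powr_add powr_minus field_simps)
      then show "ennreal (\<tau> powr (a + 2)) * ennreal (g z / \<tau>\<^sup>2 * ((4 * pi * \<tau>) powr (-a) * E z))
          = ennreal (g z * ((4 * pi) powr (-a) * E z))"
        by (metis ennreal_mult' powr_ge_zero)
    qed
    finally show ?thesis .
  qed

  define H where "H p = (case p of (y, s) \<Rightarrow>
      ennreal (f s y * (a / (T - s))) * indicator (heat_ball r X T) (y, s))" for p
  \<comment> \<open>The heat ball condition, written in \<open>z\<close> and solved for time, is
    \<open>\<tau> powr a < K z\<close>.\<close>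
  define K where "K z = r powr (2 * a) * ((4 * pi) powr (-a) * E z)" for z
  have K0: "K z > 0" for z using r E0 by (simp add: K_def)
  have K[measurable]: "K \<in> borel_measurable borel" unfolding K_def by measurable
  have ball[measurable]: "heat_ball r X T \<in> sets (borel \<Otimes>\<^sub>M borel)"
  proof -
    have "{p \<in> space (borel \<Otimes>\<^sub>M borel). snd p < T \<and>
        heat_kernel X T (fst p) (snd p) > r powr (- (real CARD('n) - 4))} \<in> sets (borel \<Otimes>\<^sub>M borel)"
      unfolding heat_kernel_def by measurable
    then show ?thesis by (simp add: heat_ball_def space_pair_measure case_prod_unfold)
  qed
  \<comment> \<open>The scaling law says nothing about \<open>f\<close> for
    \<open>s \<ge> T\<close>, but the indicator vanishes there. In this form joint measurability in
    \<open>(y, s)\<close> is visible.\<close>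
  have H_eq: "H = (\<lambda>(y, s). ennreal (g ((1 / sqrt (T - s)) *\<^sub>R (y - X)) / (T - s)\<^sup>2 * (a / (T - s)))
      * indicator (heat_ball r X T) (y, s))"
    by (auto simp: H_def fun_eq_iff f_g' heat_ball_def indicator_def)
  have H[measurable]: "H \<in> borel_measurable (borel \<Otimes>\<^sub>M borel)"
    unfolding H_eq by measurable
  have "(\<integral>\<^sup>+(y, s)\<in>heat_ball r X T. ennreal (f s y * ((real CARD('n) - 4) / (2 * (T - s)))) \<partial>lborel)
      = integral\<^sup>N (lborel \<Otimes>\<^sub>M lborel) H"
    unfolding half lborel_prod H_def[abs_def] case_prod_unfold by simp
  \<comment> \<open>Time is outermost, so that the dilation by \<open>sqrt (T - s)\<close> is a
    substitution in \<open>y\<close> alone.\<close>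
  also have "\<dots> = (\<integral>\<^sup>+s. \<integral>\<^sup>+y. H (y, s) \<partial>lborel \<partial>lborel)"
    by (rule lborel_pair.nn_integral_snd[symmetric]) simp
  also have "\<dots> = (\<integral>\<^sup>+s. \<integral>\<^sup>+z. ennreal (g z) *
      ennreal (if s < T \<and> (T - s) powr a < K z then a * (T - s) powr (a - 1) else 0) \<partial>lborel \<partial>lborel)"
  proof (rule nn_integral_cong)
    fix s
    show "(\<integral>\<^sup>+y. H (y, s) \<partial>lborel) = (\<integral>\<^sup>+z. ennreal (g z) *
      ennreal (if s < T \<and> (T - s) powr a < K z then a * (T - s) powr (a - 1) else 0) \<partial>lborel)"
    proof (cases "s < T")
      case False
      then show ?thesis by (simp add: H_def heat_ball_def)
    next
      case True
      define \<tau> where "\<tau> = T - s"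
      have \<tau>: "\<tau> > 0" "T - \<tau> = s" using True by (auto simp: \<tau>_def)
      have "(\<integral>\<^sup>+y. H (y, s) \<partial>lborel) = ennreal (\<tau> powr (a + 2)) * (\<integral>\<^sup>+z. H (X + sqrt \<tau> *\<^sub>R z, s) \<partial>lborel)"
        using \<tau>(1) by (subst nn_integral_scaleR_affine[where c = "sqrt \<tau>" and t = X])
          (auto simp: volume[symmetric])
      also have "\<dots> = (\<integral>\<^sup>+z. ennreal (\<tau> powr (a + 2)) * H (X + sqrt \<tau> *\<^sub>R z, s) \<partial>lborel)"
        by (rule nn_integral_cmult[symmetric]) measurable
      also have "\<dots> = (\<integral>\<^sup>+z. ennreal (g z) *
        ennreal (if s < T \<and> (T - s) powr a < K z then a * (T - s) powr (a - 1) else 0) \<partial>lborel)"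
      proof (intro nn_integral_cong)
        fix z
        have "(4 * pi * \<tau>) powr (-a) * E z > r powr (- (2 * a)) \<longleftrightarrow> \<tau> powr a < K z"
          using \<tau>(1) r by (simp add: K_def powr_mult powr_minus field_simps)
        then have ball_iff: "(X + sqrt \<tau> *\<^sub>R z, s) \<in> heat_ball r X T \<longleftrightarrow> \<tau> powr a < K z"
          using heat_kernel_parabolic[OF \<tau>(1), of X T z] True by (simp add: heat_ball_def \<tau>(2) a2 E_def)
        \<comment> \<open>The Jacobian against \<open>\<tau>\<^sup>2 * \<tau>\<close> leaves the
          exponent \<open>a - 1\<close> of the layer integral.\<close>
        have "\<tau> powr (a + 2) * (g z / \<tau>\<^sup>2 * (a / \<tau>)) = g z * (a * \<tau> powr (a - 1))"
          using \<tau>(1) by (simp add: powr_add powr_diff field_simps)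
        then have "ennreal (\<tau> powr (a + 2)) * ennreal (g z / \<tau>\<^sup>2 * (a / \<tau>)) = ennreal (g z) * ennreal (a * \<tau> powr (a - 1))"
          by (metis ennreal_mult' powr_ge_zero g0)
        then show "ennreal (\<tau> powr (a + 2)) * H (X + sqrt \<tau> *\<^sub>R z, s) = ennreal (g z) *
            ennreal (if s < T \<and> (T - s) powr a < K z then a * (T - s) powr (a - 1) else 0)"
          using f_g[OF \<tau>(1)] True by (simp add: H_def ball_iff \<tau>(2) \<tau>_def[symmetric])
      qed
      finally show ?thesis .
    qed
  qed
  \<comment> \<open>Exchanging back puts time innermost; for fixed \<open>z\<close> the layer
    integral then gives \<open>K z\<close>.\<close>
  also have "\<dots> = (\<integral>\<^sup>+z. \<integral>\<^sup>+s. ennreal (g z) *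
      ennreal (if s < T \<and> (T - s) powr a < K z then a * (T - s) powr (a - 1) else 0) \<partial>lborel \<partial>lborel)"
    by (rule lborel_pair.Fubini') measurable
  also have "\<dots> = (\<integral>\<^sup>+z. ennreal (g z) * ennreal (K z) \<partial>lborel)"
    by (subst nn_integral_cmult) (auto simp: nn_integral_powr_layer a K0)
  also have "\<dots> = (\<integral>\<^sup>+z. ennreal (r powr (2 * a)) * ennreal (g z * ((4 * pi) powr (-a) * E z)) \<partial>lborel)"
    using r g0 E0 by (intro nn_integral_cong)
      (simp add: K_def ennreal_mult'[symmetric] mult_ac)
  also have "\<dots> = ennreal (r powr (2 * a)) * I"
    unfolding I_def by (rule nn_integral_cmult) measurable
  finally have right: "(\<integral>\<^sup>+(y, s)\<in>heat_ball r X T.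
      ennreal (f s y * ((real CARD('n) - 4) / (2 * (T - s)))) \<partial>lborel) = ennreal (r powr (2 * a)) * I" .
  \<comment> \<open>The truncated subtraction \<open>CARD('n) - 4\<close> is a true one by
    \<open>dim\<close>.\<close>
  have "r powr (2 * a) = r ^ (CARD('n) - 4)"
    using r dim by (simp add: powr_realpow[symmetric] a2[symmetric] of_nat_diff)
  then have "ennreal (1 / r ^ (CARD('n) - 4)) * (ennreal (r powr (2 * a)) * I) = I"
    using r by (simp add: mult.assoc[symmetric] ennreal_mult'[symmetric])
  then show ?thesis using left right by simp
qed

section \<open>Bilinearity of the Lie bracket and the Killing form\<close>

text \<open>Gram-Schmidt gives a finite orthogonal spanning set. The remainder of the expansion is
  orthogonal to it, hence to itself.\<close>

lemma finite_dim_orthogonal_expansion: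
  assumes "finite_dim TYPE('a::real_inner)"
  obtains C :: "'a::real_inner set" where "finite C" "\<And>x. x = (\<Sum>b\<in>C. ((x \<bullet> b) / (b \<bullet> b)) *\<^sub>R b)"
proof -
  obtain B :: "'a set" where "finite B" "span B = UNIV"
    using assms by (auto simp: finite_dim_def)
  then obtain C :: "'a set" where C: "finite C" "span C = UNIV" "pairwise orthogonal C"
    using basis_orthogonal[of B] by metis
  have "x = (\<Sum>b\<in>C. ((x \<bullet> b) / (b \<bullet> b)) *\<^sub>R b)" for x
  proof -
    define y where "y = x - (\<Sum>b\<in>C. ((x \<bullet> b) / (b \<bullet> b)) *\<^sub>R b)"
    have "orthogonal y c" if "c \<in> C" for c
    proof -
      \<comment> \<open>\<open>C\<close> may contain 0; division by zero gives 0, and that term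
        vanishes on both sides.\<close>
      have "(\<Sum>b\<in>C. ((x \<bullet> b) / (b \<bullet> b)) *\<^sub>R b) \<bullet> c = (\<Sum>b\<in>C. if b = c then x \<bullet> c else 0)"
        unfolding inner_sum_left
        using C(3) that by (intro sum.cong) (auto simp: pairwise_def orthogonal_def)
      then show ?thesis
        using C(1) that by (simp add: y_def orthogonal_def inner_diff_left)
    qed
    then have "orthogonal y y"
      using C(2) by (intro orthogonal_to_span[of y C]) auto
    then show ?thesis by (simp add: y_def orthogonal_self)
  qed
  with C(1) that show thesis by blast
qed

text \<open>The expansion writes \<open>f\<close> as a finite sum of fixed vectors with continuous
  coefficients.\<close>

lemma finite_dim_linear_continuous_on:
  fixes f :: "'a::real_inner \<Rightarrow> 'b::real_normed_vector"
  assumes "finite_dim TYPE('a)" and f: "linear f"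
  shows "continuous_on S f"
proof -
  obtain C :: "'a set" where C: "finite C" "\<And>x. x = (\<Sum>b\<in>C. ((x \<bullet> b) / (b \<bullet> b)) *\<^sub>R b)"
    using finite_dim_orthogonal_expansion[OF assms(1)] by blast
  have eq: "f x = (\<Sum>b\<in>C. ((x \<bullet> b) / (b \<bullet> b)) *\<^sub>R f b)" for x
    by (subst C(2)) (simp only: linear_sum[OF f] linear_scale[OF f])
  have "continuous_on S (\<lambda>x. \<Sum>b\<in>C. ((x \<bullet> b) / (b \<bullet> b)) *\<^sub>R f b)"
    by (auto simp: divide_inverse intro!: continuous_intros)
  then show ?thesis by (simp only: eq[symmetric])
qed

text \<open>Expanding the first argument leaves finitely many maps linear in the second.\<close>

lemma finite_dim_bilinear_continuous_on:
  fixes h :: "'a::real_inner \<Rightarrow> 'b::real_inner \<Rightarrow> 'c::real_normed_vector"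
  assumes fin: "finite_dim TYPE('a)" "finite_dim TYPE('b)" and h: "bilinear h"
    and f: "continuous_on S f" and g: "continuous_on S g"
  shows "continuous_on S (\<lambda>x. h (f x) (g x))"
proof -
  have lin: "linear (h x)" "linear (\<lambda>x. h x y)" for x y
    using h by (auto simp: bilinear_def)
  obtain C :: "'a set" where C: "finite C" "\<And>x. x = (\<Sum>b\<in>C. ((x \<bullet> b) / (b \<bullet> b)) *\<^sub>R b)"
    using finite_dim_orthogonal_expansion[OF fin(1)] by blast
  have eq: "h x y = (\<Sum>b\<in>C. ((x \<bullet> b) / (b \<bullet> b)) *\<^sub>R h b y)" for x y
    by (subst C(2)) (simp only: linear_sum[OF lin(2)] linear_scale[OF lin(2)])
  have cont: "continuous_on S (\<lambda>x. h b (g x))" for b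
    using finite_dim_linear_continuous_on[OF fin(2) lin(1)] g
    by (rule continuous_on_compose2) auto
  have "continuous_on S (\<lambda>x. \<Sum>b\<in>C. ((f x \<bullet> b) / (b \<bullet> b)) *\<^sub>R h b (g x))"
    by (auto simp: divide_inverse intro!: continuous_intros f cont)
  then show ?thesis by (simp only: eq[symmetric])
qed

section \<open>The trace and the Killing form\<close>

text \<open>The basis picked by \<open>SOME\<close> does not depend on the endomorphism, so traces
  can be compared termwise.\<close>

lemma lin_trace_basis:
  obtains B :: "'a::real_vector set" where "independent B" "span B = UNIV"
    "\<And>f. lin_trace f = (\<Sum>b\<in>B. representation B (f b) b)"
proof -
  define B :: "'a set" where "B = (SOME B. independent B \<and> span B = UNIV)"
  have "\<exists>B::'a set. independent B \<and> span B = UNIV"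
    using independent_extend_basis[OF independent_empty] span_extend_basis[OF independent_empty] by blast
  then have "independent B \<and> span B = UNIV"
    unfolding B_def by (rule someI_ex)
  with that show thesis by (auto simp: lin_trace_def B_def Let_def)
qed

lemma ad_inner_scaleR:
  assumes br: "bilinear br"
  shows "ad_inner br (k *\<^sub>R Y) (k *\<^sub>R Z) = k\<^sup>2 * ad_inner br Y Z"
proof -
  obtain B :: "'a set" where B: "independent B" "span B = UNIV"
    "\<And>f. lin_trace f = (\<Sum>b\<in>B. representation B (f b) b)"
    by (rule lin_trace_basis) blast
  show ?thesis
    by (simp add: ad_inner_def B bilinear_lmul[OF br] bilinear_rmul[OF br] representation_scale
        sum_distrib_left power2_eq_square mult.assoc)
qed

text \<open>Each term of the trace is a linear coordinate applied to two nested brackets.\<close>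

lemma continuous_on_ad_inner:
  fixes br :: "'g::real_inner \<Rightarrow> 'g \<Rightarrow> 'g"
  assumes fin: "finite_dim TYPE('g)" and br: "bilinear br"
    and f: "continuous_on S f" and g: "continuous_on S g"
  shows "continuous_on S (\<lambda>x. ad_inner br (f x) (g x))"
proof -
  obtain B :: "'g set" where B: "independent B" "span B = UNIV"
    "\<And>f. lin_trace f = (\<Sum>b\<in>B. representation B (f b) b)"
    by (rule lin_trace_basis) blast
  have "linear (\<lambda>Y. representation B Y b)" for b
    by (rule linearI) (simp_all add: B representation_add representation_scale)
  note rep = finite_dim_linear_continuous_on[OF fin this, of UNIV]
  show ?thesis
    unfolding ad_inner_def B o_def
    by (intro continuous_intros continuous_on_compose2[OF rep]
        finite_dim_bilinear_continuous_on[OF fin fin br] f g) auto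
qed

text \<open>No positivity of the form is needed, since \<^term>\<open>sqrt\<close> is an odd function on all reals.\<close>

lemma ad_norm_power2: "(ad_norm br Z)\<^sup>2 = \<bar>ad_inner br Z Z\<bar>"
  by (metis ad_norm_def power2_abs real_sqrt_abs2 power2_eq_square real_sqrt_mult)

section \<open>The bracket of left-invariant fields in a chart\<close>

text \<open>Linearity in the parameter holds on a whole neighbourhood of \<open>p\<close>, so it
  passes to the derivatives at \<open>p\<close> by their uniqueness.\<close>

lemma bilinear_vector_field_bracket:
  fixes \<xi> :: "'g::real_normed_vector \<Rightarrow> 'g \<Rightarrow> 'g"
  assumes S: "open S" "p \<in> S" and lin: "\<And>x. x \<in> S \<Longrightarrow> linear (\<lambda>Z. \<xi> Z x)"
    and diff: "\<And>Z. \<xi> Z differentiable (at p)"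
  shows "bilinear (\<lambda>Y Z. vector_field_bracket (\<xi> Y) (\<xi> Z) p)"
proof -
  let ?D = "\<lambda>Z. frechet_derivative (\<xi> Z) (at p)"
  have D: "(\<xi> Z has_derivative ?D Z) (at p)" for Z
    using diff frechet_derivative_works by blast
  have linD: "linear (?D Z)" for Z
    using diff by (rule linear_frechet_derivative)
  have "(\<xi> (Y + Z) has_derivative (\<lambda>v. ?D Y v + ?D Z v)) (at p)" for Y Z
    by (rule has_derivative_transform_within_open[OF has_derivative_add[OF D D] S])
      (simp add: linear_add[OF lin])
  then have add: "?D (Y + Z) = (\<lambda>v. ?D Y v + ?D Z v)" for Y Z
    using frechet_derivative_at by metis
  have "(\<xi> (k *\<^sub>R Z) has_derivative (\<lambda>v. k *\<^sub>R ?D Z v)) (at p)" for k Z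
    by (rule has_derivative_transform_within_open[OF has_derivative_scaleR_right[OF D] S])
      (simp add: linear_scale[OF lin])
  then have scale: "?D (k *\<^sub>R Z) = (\<lambda>v. k *\<^sub>R ?D Z v)" for k Z
    using frechet_derivative_at by metis
  show ?thesis
    unfolding bilinear_def vector_field_bracket_def
    by (intro conjI allI linearI)
      (simp_all add: add scale linear_add[OF lin[OF S(2)]] linear_scale[OF lin[OF S(2)]]
        linear_add[OF linD] linear_scale[OF linD] algebra_simps)
qed

lemma is_chart_image_open:
  assumes "is_chart X (U, \<phi>)" "openin X V" "V \<subseteq> U"
  shows "open (\<phi> ` V)"
proof -
  have "openin (subtopology X U) V"
    using assms(2,3) by (simp add: openin_subset_topspace_eq openin_subtopology_Int2 inf.absorb2 openin_subtopology)
       (metis inf.absorb1)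
  then have "openin (top_of_set (\<phi> ` U)) (\<phi> ` V)"
    using assms(1) homeomorphic_imp_open_map unfolding is_chart_def open_map_def by blast
  then show ?thesis
    using assms(1) by (auto simp: is_chart_def openin_open_eq)
qed

lemma is_chart_inj_on:
  assumes "is_chart X (U, \<phi>)"
  shows "inj_on \<phi> U"
proof -
  have "U \<subseteq> topspace X" using assms openin_subset by (auto simp: is_chart_def)
  then show ?thesis
    using assms homeomorphic_imp_injective_map[of "subtopology X U" _ \<phi>]
    by (auto simp: is_chart_def inf.absorb2)
qed

context lie_group
begin

text \<open>Near \<open>\<one>\<close> the multiplication reads as a smooth map \<open>m\<close> in
  the chart. A left-invariant field is a directional derivative of \<open>m\<close>, so it depends
  linearly on its generator and is differentiable in the base point.\<close>

lemma bilinear_lie_bracket: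
  assumes c: "c \<in> \<A>" "\<one> \<in> fst c"
  shows "bilinear (lie_bracket G c)"
proof -
  obtain U \<phi> where c_eq: "c = (U, \<phi>)" by (cases c)
  have U: "(U, \<phi>) \<in> \<A>" "\<one> \<in> U" using c c_eq by auto
  then have chart: "is_chart X (U, \<phi>)" using atlas by (auto simp: smooth_atlas_def)
  note inj = is_chart_inj_on[OF chart]
  have oU: "openin X U" and Us: "U \<subseteq> carrier G"
    using chart openin_subset topspace by (auto simp: is_chart_def)
  define p where "p = \<phi> \<one>"
  define \<psi> where "\<psi> = inv_into U \<phi>"
  let ?mul = "\<lambda>(g, h). g \<otimes> h"
  define S where "S = map_prod \<phi> \<phi> ` ((U \<times> U) \<inter> ?mul -` U)"
  define m where "m = \<phi> \<circ> ?mul \<circ> inv_into (U \<times> U) (map_prod \<phi> \<phi>)"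
  have "(U \<times> U, map_prod \<phi> \<phi>) \<in> prod_atlas \<A> \<A>" using U by (auto simp: prod_atlas_def)
  then have "smooth_on S m" and cont: "continuous_map (prod_topology X X) X ?mul"
    using smooth_mult U(1) unfolding smooth_map_def S_def m_def by blast+
  \<comment> \<open>One derivative of \<open>m\<close> defines the fields, a second one
    differentiates them for the bracket.\<close>
  then have "Ck_on (Suc (Suc 0)) S m" unfolding smooth_on_def by blast
  then have m1: "\<And>z. z \<in> S \<Longrightarrow> m differentiable (at z)"
    and m2: "\<And>z v. z \<in> S \<Longrightarrow> (\<lambda>z. frechet_derivative m (at z) v) differentiable (at z)"
    by auto
  define N where "N = {z \<in> topspace (prod_topology X X). ?mul z \<in> U} \<inter> U \<times> U"
  have "openin (prod_topology X X) N"
    unfolding N_def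
    by (intro openin_Int openin_continuous_map_preimage[OF cont] oU)
      (simp add: openin_prod_Times_iff oU)
  moreover have "(\<one>, \<one>) \<in> N"
    using U topspace by (auto simp: N_def)
  ultimately have "\<exists>V1 V2. openin X V1 \<and> openin X V2 \<and> \<one> \<in> V1 \<and> \<one> \<in> V2 \<and> V1 \<times> V2 \<subseteq> N"
    by (simp add: openin_prod_topology_alt)
  then obtain V1 V2 where V: "openin X V1" "openin X V2" "\<one> \<in> V1" "\<one> \<in> V2" "V1 \<times> V2 \<subseteq> N"
    by blast
  \<comment> \<open>One neighbourhood for both factors, small enough that all products stay in the
    chart domain.\<close>
  define V where "V = V1 \<inter> V2"
  have V_open: "openin X V" and one_V: "\<one> \<in> V"
    using V by (simp_all add: V_def openin_Int)
  have V_N: "(g, h) \<in> N" if "g \<in> V" "h \<in> V" for g h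
    using V(5) that unfolding V_def by blast
  have V_mul: "g \<otimes> h \<in> U" if "g \<in> V" "h \<in> V" for g h
    using V_N[OF that] by (simp add: N_def)
  have VU: "V \<subseteq> U"
    using V_N[OF _ one_V] by (auto simp: N_def)
  define Q where "Q = \<phi> ` V"
  have Q: "open Q" "p \<in> Q"
    using is_chart_image_open[OF chart V_open VU] one_V by (auto simp: Q_def p_def)
  have QS: "(x, y) \<in> S" if "x \<in> Q" "y \<in> Q" for x y
    using that VU V_mul by (force simp: Q_def S_def)
  have m_eq: "m (x, y) = \<phi> (\<psi> x \<otimes> \<psi> y)" if xy: "x \<in> Q" "y \<in> Q" for x y
  proof -
    obtain g h where gh: "g \<in> U" "h \<in> U" "x = \<phi> g" "y = \<phi> h"
      using xy VU by (auto simp: Q_def)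
    have "inv_into (U \<times> U) (map_prod \<phi> \<phi>) (x, y) = (g, h)"
      using gh map_prod_inj_on[OF inj inj] by (intro inv_into_f_eq) auto
    then show ?thesis
      using gh inj by (simp add: m_def \<psi>_def)
  qed
  \<comment> \<open>The left-invariant fields are partial derivatives of \<open>m\<close>, the multiplication in the chart,
    in its second argument at \<open>p\<close>.\<close>
  define \<xi> where "\<xi> = left_invariant_field G c"
  have \<xi>_eq: "\<xi> Z x = frechet_derivative m (at (x, p)) (0, Z)" if x: "x \<in> Q" for Z x
  proof -
    have "(m has_derivative frechet_derivative m (at (x, p))) (at (x, p))"
      using m1 QS[OF x Q(2)] frechet_derivative_works by blast
    then have "((m \<circ> (\<lambda>y. (x, y))) has_derivative (frechet_derivative m (at (x, p)) \<circ> (\<lambda>v. (0, v)))) (at p)"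
      by (intro diff_chain_at has_derivative_Pair has_derivative_const has_derivative_ident)
    then have "((\<lambda>y. \<phi> (\<psi> x \<otimes> \<psi> y)) has_derivative
        (frechet_derivative m (at (x, p)) \<circ> (\<lambda>v. (0, v)))) (at p)"
      by (rule has_derivative_transform_within_open[OF _ Q]) (simp add: m_eq x)
    from frechet_derivative_at[OF this, symmetric] show ?thesis
      by (simp add: \<xi>_def left_invariant_field_def c_eq \<psi>_def p_def)
  qed
  have "linear (\<lambda>Z. \<xi> Z x)" if x: "x \<in> Q" for x
  proof -
    interpret D: linear "frechet_derivative m (at (x, p))"
      using m1[OF QS[OF x Q(2)]] by (rule linear_frechet_derivative)
    show ?thesis
      by (rule linearI) (simp_all add: \<xi>_eq x flip: D.add D.scale)
  qed
  moreover have "\<xi> Z differentiable (at p)" for Z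
  proof -
    \<comment> \<open>The field is the derivative of \<open>m\<close> in direction
      \<open>(0, Z)\<close>, restricted to the points \<open>(x, p)\<close>.\<close>
    have "(\<lambda>z. frechet_derivative m (at z) (0, Z)) differentiable (at (p, p))"
      using m2 QS[OF Q(2) Q(2)] by blast
    moreover have "(\<lambda>x. (x, p)) differentiable (at p)"
      unfolding differentiable_def
      using has_derivative_Pair[OF has_derivative_ident has_derivative_const] by blast
    ultimately have "((\<lambda>z. frechet_derivative m (at z) (0, Z)) \<circ> (\<lambda>x. (x, p))) differentiable (at p)"
      by (intro differentiable_chain_at) auto
    then obtain D where "((\<lambda>x. frechet_derivative m (at (x, p)) (0, Z)) has_derivative D) (at p)"
      by (auto simp: differentiable_def o_def)
    then have "(\<xi> Z has_derivative D) (at p)"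
      by (rule has_derivative_transform_within_open[OF _ Q]) (simp add: \<xi>_eq)
    then show ?thesis by (auto simp: differentiable_def)
  qed
  ultimately have "bilinear (\<lambda>Y Z. vector_field_bracket (\<xi> Y) (\<xi> Z) p)"
    by (intro bilinear_vector_field_bracket[OF Q])
  then show ?thesis
    by (simp add: lie_bracket_def[abs_def] \<xi>_def c_eq p_def)
qed

end

section \<open>Parabolic scaling of the curvature energy\<close>

text \<open>Chain rule along \<open>x \<mapsto> (x, t)\<close>: it turns joint smoothness in space
  and time into statements about time slices.\<close>

lemma frechet_derivative_slice:
  fixes f :: "'a::real_normed_vector \<Rightarrow> 'b::real_normed_vector \<Rightarrow> 'c::real_normed_vector"
  assumes "(\<lambda>(x, t). f t x) differentiable (at (x, t))"
  shows "(f t has_derivative (\<lambda>v. frechet_derivative (\<lambda>(x, t). f t x) (at (x, t)) (v, 0))) (at x)"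
proof -
  let ?f = "\<lambda>(x, t). f t x"
  have "(?f has_derivative frechet_derivative ?f (at (x, t))) (at (x, t))"
    using assms frechet_derivative_works by blast
  then have "((?f \<circ> (\<lambda>x. (x, t))) has_derivative (frechet_derivative ?f (at (x, t)) \<circ> (\<lambda>v. (v, 0)))) (at x)"
    by (intro diff_chain_at has_derivative_Pair has_derivative_const has_derivative_ident)
  then show ?thesis by (simp add: o_def)
qed

text \<open>One factor \<open>r\<close> is the prefactor, the other comes from the inner dilation by
  the chain rule.\<close>

lemma partial_parabolic_scaling:
  fixes f :: "real \<Rightarrow> real^'n \<Rightarrow> 'b::real_normed_vector"
  assumes eq: "\<And>x. f t x = r *\<^sub>R f t' (X + r *\<^sub>R (x - X))"
    and diff: "\<And>x. f t' differentiable (at x)"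
  shows "partial i (f t) x = r\<^sup>2 *\<^sub>R partial i (f t') (X + r *\<^sub>R (x - X))"
proof -
  let ?s = "\<lambda>x. X + r *\<^sub>R (x - X)"
  have "(?s has_derivative (\<lambda>v. r *\<^sub>R v)) (at x)"
    by (auto intro!: derivative_eq_intros simp: algebra_simps)
  moreover have D: "(f t' has_derivative frechet_derivative (f t') (at (?s x))) (at (?s x))"
    using diff frechet_derivative_works by blast
  ultimately have "((f t' \<circ> ?s) has_derivative (frechet_derivative (f t') (at (?s x)) \<circ> (\<lambda>v. r *\<^sub>R v))) (at x)"
    by (rule diff_chain_at)
  then have "((\<lambda>x. r *\<^sub>R f t' (?s x)) has_derivative (\<lambda>v. r *\<^sub>R frechet_derivative (f t') (at (?s x)) (r *\<^sub>R v))) (at x)"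
    by (intro has_derivative_scaleR_right) (simp add: o_def)
  moreover have "f t = (\<lambda>x. r *\<^sub>R f t' (?s x))" using eq by blast
  ultimately have "frechet_derivative (f t) (at x) = (\<lambda>v. r *\<^sub>R frechet_derivative (f t') (at (?s x)) (r *\<^sub>R v))"
    using frechet_derivative_at by metis
  then show ?thesis
    by (simp add: partial_def linear_scale[OF linear_frechet_derivative[OF diff]] power2_eq_square)
qed

text \<open>What remains of \<open>energy_density\<close> when \<open>Du\<close> and the potential
  vanish.\<close>

definition curvature_energy ::
  "('g::real_normed_vector \<Rightarrow> 'g \<Rightarrow> 'g) \<Rightarrow> ('n::{finite, linorder} \<Rightarrow> (real, 'n) vec \<Rightarrow> 'g) \<Rightarrow> (real, 'n) vec \<Rightarrow> real" where
  "curvature_energy br A x = 1/2 * (\<Sum>(i, j)\<in>{(i, j). i < j}. (ad_norm br (curvature br A i j x))\<^sup>2)"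

lemma curvature_energy_nonneg: "curvature_energy br A x \<ge> 0"
  by (auto simp: curvature_energy_def intro!: sum_nonneg)

lemma continuous_on_curvature_energy:
  fixes br :: "'g::real_inner \<Rightarrow> 'g \<Rightarrow> 'g"
  assumes fin: "finite_dim TYPE('g)" and br: "bilinear br"
    and "\<And>i. continuous_on S (A i)" "\<And>i j. continuous_on S (partial i (A j))"
  shows "continuous_on S (curvature_energy br A)"
  unfolding curvature_energy_def ad_norm_power2 curvature_def case_prod_unfold
  by (intro continuous_intros continuous_on_ad_inner[OF fin br]
      finite_dim_bilinear_continuous_on[OF fin fin br] assms)

text \<open>Derivatives of \<open>A\<close> gain \<open>r\<^sup>2\<close> by the chain rule and the
  bracket gains \<open>r\<^sup>2\<close> by bilinearity, so the curvature is homogeneous and its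
  square gains \<open>r ^ 4\<close>.\<close>

lemma curvature_energy_parabolic_scaling:
  fixes A :: "real \<Rightarrow> 'n::{finite, linorder} \<Rightarrow> (real, 'n) vec \<Rightarrow> 'g::real_inner"
  assumes br: "bilinear br"
    and eq: "\<And>i x. A t i x = r *\<^sub>R A t' i (X + r *\<^sub>R (x - X))"
    and diff: "\<And>i x. A t' i differentiable (at x)"
  shows "curvature_energy br (A t) x = r ^ 4 * curvature_energy br (A t') (X + r *\<^sub>R (x - X))"
proof -
  let ?x = "X + r *\<^sub>R (x - X)"
  have partial: "partial i (A t j) x = r\<^sup>2 *\<^sub>R partial i (A t' j) ?x" for i j
    using partial_parabolic_scaling[of "\<lambda>t. A t j"] eq diff by blast
  have "curvature br (A t) i j x = r\<^sup>2 *\<^sub>R curvature br (A t') i j ?x" for i j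
    unfolding curvature_def partial eq[of _ x]
    by (simp add: bilinear_lmul[OF br] bilinear_rmul[OF br] power2_eq_square algebra_simps)
  then have "(ad_norm br (curvature br (A t) i j x))\<^sup>2 = r ^ 4 * (ad_norm br (curvature br (A t') i j ?x))\<^sup>2" for i j
    by (simp add: ad_norm_power2 ad_inner_scaleR[OF br] abs_mult flip: power_mult)
  then show ?thesis
    by (simp add: curvature_energy_def sum_distrib_left case_prod_unfold mult_ac)
qed

section \<open>The theorem as an instance of the mean value formula\<close>

theorem proposition2p2:
  fixes G :: "('a, 'm) monoid_scheme"
    and GT :: "'a topology"
    and \<A> :: "('a, 'g::real_inner) chart set"
    and c :: "('a, 'g) chart"
    and \<rho> :: "'a \<Rightarrow> 'v::real_inner \<Rightarrow>\<^sub>L 'v"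
    and W :: "real \<Rightarrow> real"
    and A :: "real \<Rightarrow> 'n::{finite, linorder} \<Rightarrow> (real, 'n) vec \<Rightarrow> 'g"
    and u :: "real \<Rightarrow> (real, 'n) vec \<Rightarrow> 'v"
    and X :: "(real, 'n) vec" and T :: real
    and br :: "'g \<Rightarrow> 'g \<Rightarrow> 'g"
    and act :: "'g \<Rightarrow> 'v \<Rightarrow> 'v"
  assumes br_def: "br = lie_bracket G c"
    and act_def: "act = lie_action G c \<rho>"
    and lie_group: "lie_group G GT \<A>"
    and compact: "compact_space GT"
    and connected: "connected_space GT"
    and chart_at_one: "c \<in> \<A>" "\<one>\<^bsub>G\<^esub> \<in> fst c"
    and semisimple: "semisimple_lie_algebra br"
    and representation: "orthogonal_representation G GT \<A> \<rho>"
    and W_C1: "W C1_differentiable_on UNIV"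
    and W_nonneg: "\<And>z. W z \<ge> 0"
    and dim: "CARD('n) > 4"
    and smooth_A: "\<And>i. smooth_on (UNIV \<times> {..<T}) (\<lambda>(x, t). A t i x)"
    and smooth_u: "smooth_on (UNIV \<times> {..<T}) (\<lambda>(x, t). u t x)"
    and self_similar: "\<And>r i x t. r > 0 \<Longrightarrow> t < T \<Longrightarrow>
           r *\<^sub>R A (T + r\<^sup>2 * (t - T)) i (X + r *\<^sub>R (x - X)) = A t i x"
    and parallel: "\<And>i x t. t < T \<Longrightarrow> covariant_derivative act (A t) i (u t) x = 0"
    and potential_zero: "\<And>x t. t < T \<Longrightarrow> W ((norm (u t x))\<^sup>2) = 0"
  shows "\<forall>t<T. \<forall>r>0.
    (\<integral>\<^sup>+x. ennreal (energy_density br act W (A t) (u t) x * heat_kernel X T x t) \<partial>lborel) =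
    ennreal (1 / r ^ (CARD('n) - 4)) *
    (\<integral>\<^sup>+(y, s)\<in>heat_ball r X T.
        ennreal (energy_density br act W (A s) (u s) y * ((real CARD('n) - 4) / (2 * (T - s))))
      \<partial>lborel)"
proof (intro allI impI)
  fix t r :: real assume t: "t < T" and r: "r > 0"
  have fin: "finite_dim TYPE('g)"
    using lie_group by (simp add: lie_group_def lie_group_axioms_def)
  have br: "bilinear br"
    unfolding br_def using lie_group chart_at_one by (rule lie_group.bilinear_lie_bracket)
  have A1: "Ck_on (Suc 0) (UNIV \<times> {..<T}) (\<lambda>(x, t). A t i x)" for i
    using smooth_A by (simp add: smooth_on_def del: Ck_on.simps)
  then have diff: "(\<lambda>(x, t). A t i x) differentiable (at (x, s))" if "s < T" for i x s
    using that by auto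
  note slice = frechet_derivative_slice[OF diff]
  have A_diff: "A s i differentiable (at x)" if "s < T" for i x s
    using slice[OF that] unfolding differentiable_def by blast
  have partial_A: "partial j (A s i)
      = (\<lambda>x. frechet_derivative (\<lambda>(x, t). A t i x) (at (x, s)) (axis j 1, 0))" if "s < T" for i j s
    unfolding partial_def using frechet_derivative_at[OF slice[OF that]] by metis
  \<comment> \<open>Only the slice at \<open>T - 1\<close> enters the measurability premise of
    \<open>heat_ball_mean_value\<close>.\<close>
  have cont_partial: "continuous_on UNIV (partial j (A (T - 1) i))" for i j
  proof -
    have "continuous_on (UNIV \<times> {..<T}) (\<lambda>z. frechet_derivative (\<lambda>(x, t). A t i x) (at z) (axis j 1, 0))"
      using A1 by simp
    then have "continuous_on UNIV
        (\<lambda>x. frechet_derivative (\<lambda>(x, t). A t i x) (at (x, T - 1)) (axis j 1, 0))"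
      by (rule continuous_on_compose2) (auto intro!: continuous_intros)
    then show ?thesis by (simp add: partial_A)
  qed
  have energy: "energy_density br act W (A s) (u s) x = curvature_energy br (A s) x" if "s < T" for s x
    using parallel potential_zero that by (simp add: energy_density_def curvature_energy_def)
  have "(\<integral>\<^sup>+x. ennreal (curvature_energy br (A t) x * heat_kernel X T x t) \<partial>lborel) =
    ennreal (1 / r ^ (CARD('n) - 4)) *
    (\<integral>\<^sup>+(y, s)\<in>heat_ball r X T.
        ennreal (curvature_energy br (A s) y * ((real CARD('n) - 4) / (2 * (T - s)))) \<partial>lborel)"
  proof (rule heat_ball_mean_value[OF dim])
    have "continuous_on UNIV (A (T - 1) i)" for i
      using A_diff[of "T - 1" i]
      by (intro differentiable_imp_continuous_on) (auto simp: differentiable_on_def intro: differentiable_at_withinI)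
    then show "curvature_energy br (A (T - 1)) \<in> borel_measurable borel"
      by (intro borel_measurable_continuous_onI continuous_on_curvature_energy fin br cont_partial)
    show "q ^ 4 * curvature_energy br (A (T + q\<^sup>2 * (s - T))) (X + q *\<^sub>R (x - X)) = curvature_energy br (A s) x"
      if q: "q > 0" and s: "s < T" for q s x
    proof (rule curvature_energy_parabolic_scaling[OF br, symmetric])
      show "A s i x = q *\<^sub>R A (T + q\<^sup>2 * (s - T)) i (X + q *\<^sub>R (x - X))" for i x
        using self_similar[OF q s] by simp
      \<comment> \<open>Dilation about \<open>T\<close> keeps times before \<open>T\<close>, where
        \<open>A\<close> is smooth.\<close>
      have "T + q\<^sup>2 * (s - T) < T" using q s by (simp add: mult_pos_neg)
      then show "A (T + q\<^sup>2 * (s - T)) i differentiable (at x)" for i x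
        by (rule A_diff)
    qed
  qed (use t r in \<open>auto simp: curvature_energy_nonneg\<close>)
  \<comment> \<open>The two energies are known to agree only for \<open>s < T\<close>, which
    membership in the heat ball guarantees.\<close>
  also have "(\<integral>\<^sup>+(y, s)\<in>heat_ball r X T.
        ennreal (curvature_energy br (A s) y * ((real CARD('n) - 4) / (2 * (T - s)))) \<partial>lborel) =
    (\<integral>\<^sup>+(y, s)\<in>heat_ball r X T.
        ennreal (energy_density br act W (A s) (u s) y * ((real CARD('n) - 4) / (2 * (T - s)))) \<partial>lborel)"
    by (intro nn_integral_cong) (auto simp: energy heat_ball_def indicator_def)
  finally show "(\<integral>\<^sup>+x. ennreal (energy_density br act W (A t) (u t) x * heat_kernel X T x t) \<partial>lborel) =
    ennreal (1 / r ^ (CARD('n) - 4)) *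
    (\<integral>\<^sup>+(y, s)\<in>heat_ball r X T.
        ennreal (energy_density br act W (A s) (u s) y * ((real CARD('n) - 4) / (2 * (T - s))))
      \<partial>lborel)"
    by (simp only: energy[OF t])
qed

end
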